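(* Let $R$ be an $n$-Peirce ring and let $f=f^2\in R$ be an arbitrary Peirce trivial idempotent. Then $fRf$ is a $k$-Peirce ring for some $k\le n$, and $(1-f)R(1-f)$ is an $(n-k)$-Peirce ring.
   Context: All rings are associative with identity; for an idempotent $e$ of a ring $R$, $eRe$ is a ring with identity $e$. An idempotent $e\in R$ is inner Peirce trivial if $eR(1-e)Re=0$, outer Peirce trivial if $(1-e)ReR(1-e)=0$, and Peirce trivial if it is both. A ring is a $0$-Peirce ring if it has only one element ($1=0$). A ring $R$ is a $1$-Peirce ring if $1\neq 0$ and $0,1$ are its only Peirce trivial idempotents. Inductively, for a natural number $n>1$, $R$ is an $n$-Peirce ring if there are a Peirce trivial idempotent $e\in R$ and an integer $m$ with $1\le m<n$ such that $eRe$ is an $m$-Peirce ring and $(1-e)R(1-e)$ is an $(n-m)$-Peirce ring. *)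

theory Defs
  imports "HOL-Algebra.Ring"
begin

text \<open>The Peirce corner \<open>eRe\<close>: the operations and zero are those of \<open>R\<close>, the identity is \<open>e\<close>.\<close>

definition corner :: "('a, 'b) ring_scheme \<Rightarrow> 'a \<Rightarrow> ('a, 'b) ring_scheme" where
  "corner R e =
    R\<lparr>carrier := {e \<otimes>\<^bsub>R\<^esub> x \<otimes>\<^bsub>R\<^esub> e | x. x \<in> carrier R}, one := e\<rparr>"

definition idempotent_elem :: "('a, 'b) ring_scheme \<Rightarrow> 'a \<Rightarrow> bool" where
  "idempotent_elem R e \<longleftrightarrow> e \<in> carrier R \<and> e \<otimes>\<^bsub>R\<^esub> e = e"

text \<open>
  The products \<open>eR(1 - e)Re\<close> and \<open>(1 - e)ReR(1 - e)\<close> are additive subgroups generated by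
  elementwise products, so each of them is zero iff all the elementwise products are.
\<close>

definition inner_Peirce_trivial :: "('a, 'b) ring_scheme \<Rightarrow> 'a \<Rightarrow> bool" where
  "inner_Peirce_trivial R e \<longleftrightarrow> idempotent_elem R e \<and>
    (\<forall>x\<in>carrier R. \<forall>y\<in>carrier R.
      e \<otimes>\<^bsub>R\<^esub> x \<otimes>\<^bsub>R\<^esub> (\<one>\<^bsub>R\<^esub> \<ominus>\<^bsub>R\<^esub> e) \<otimes>\<^bsub>R\<^esub> y \<otimes>\<^bsub>R\<^esub> e = \<zero>\<^bsub>R\<^esub>)"

definition outer_Peirce_trivial :: "('a, 'b) ring_scheme \<Rightarrow> 'a \<Rightarrow> bool" where
  "outer_Peirce_trivial R e \<longleftrightarrow> idempotent_elem R e \<and>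
    (\<forall>x\<in>carrier R. \<forall>y\<in>carrier R.
      (\<one>\<^bsub>R\<^esub> \<ominus>\<^bsub>R\<^esub> e) \<otimes>\<^bsub>R\<^esub> x \<otimes>\<^bsub>R\<^esub> e \<otimes>\<^bsub>R\<^esub> y \<otimes>\<^bsub>R\<^esub> (\<one>\<^bsub>R\<^esub> \<ominus>\<^bsub>R\<^esub> e) = \<zero>\<^bsub>R\<^esub>)"

definition Peirce_trivial :: "('a, 'b) ring_scheme \<Rightarrow> 'a \<Rightarrow> bool" where
  "Peirce_trivial R e \<longleftrightarrow> inner_Peirce_trivial R e \<and> outer_Peirce_trivial R e"

inductive Peirce_ring :: "nat \<Rightarrow> ('a, 'b) ring_scheme \<Rightarrow> bool" where
  Peirce_ring_0: "ring R \<Longrightarrow> carrier R = {\<zero>\<^bsub>R\<^esub>} \<Longrightarrow> Peirce_ring 0 R"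
| Peirce_ring_1: "ring R \<Longrightarrow> \<one>\<^bsub>R\<^esub> \<noteq> \<zero>\<^bsub>R\<^esub> \<Longrightarrow> {e. Peirce_trivial R e} = {\<zero>\<^bsub>R\<^esub>, \<one>\<^bsub>R\<^esub>} \<Longrightarrow>
    Peirce_ring 1 R"
| Peirce_ring_step: "ring R \<Longrightarrow> n > 1 \<Longrightarrow> Peirce_trivial R e \<Longrightarrow> 1 \<le> m \<Longrightarrow> m < n \<Longrightarrow>
    Peirce_ring m (corner R e) \<Longrightarrow> Peirce_ring (n - m) (corner R (\<one>\<^bsub>R\<^esub> \<ominus>\<^bsub>R\<^esub> e)) \<Longrightarrow>
    Peirce_ring n R"

end

theory Submission
  imports Defs "HOL-Algebra.QuotRing"
begin

text \<open>
  An idempotent \<open>e\<close> is inner Peirce trivial exactly when the compression \<open>x \<mapsto> exe\<close> is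
  multiplicative, so for a Peirce trivial \<open>e\<close> both \<open>eRe\<close> and \<open>(1 - e)R(1 - e)\<close> are homomorphic
  images of \<open>R\<close> under compression. A surjective homomorphism preserves Peirce triviality; hence for
  Peirce trivial \<open>e\<close> and \<open>f\<close> the element \<open>efe\<close> is a Peirce trivial idempotent of \<open>eRe\<close>, with
  complement \<open>e(1 - f)e\<close>, and symmetrically \<open>fef\<close> is one of \<open>fRf\<close>
  (\<open>Peirce_trivial_compression\<close>).

  The two idempotents \<open>efe = (ef)(fe)\<close> and \<open>fef = (fe)(ef)\<close> are products of the same two elements
  in opposite orders, so their corners are isomorphic (\<open>corner_swap_iso\<close>). Being \<open>n\<close>-Peirce is
  invariant under isomorphism, so a Peirce number found for the corner of \<open>efe\<close> in \<open>eRe\<close> is also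
  one for the corner of \<open>fef\<close> in \<open>fRf\<close>.

  The theorem follows by induction on the derivation that \<open>R\<close> is \<open>n\<close>-Peirce. Suppose \<open>e\<close>, with
  \<open>e' = 1 - e\<close>, splits \<open>R\<close> into an \<open>m\<close>-Peirce ring and an \<open>(n - m)\<close>-Peirce ring, and write
  \<open>f' = 1 - f\<close>. The induction hypotheses split the corner \<open>eRe\<close> along \<open>efe\<close> and the corner
  \<open>e'Re'\<close> along \<open>e'fe'\<close>, with Peirce numbers \<open>a\<close>, \<open>m - a\<close> and \<open>b\<close>, \<open>n - m - b\<close>. These four
  corners are, up to isomorphism, those of \<open>fef\<close> and \<open>fe'f\<close> in \<open>fRf\<close> (numbers \<open>a\<close> and \<open>b\<close>) and
  those of \<open>f'ef'\<close> and \<open>f'e'f'\<close> in \<open>f'Rf'\<close>. Peirce numbers of complementary corners add up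
  (\<open>Peirce_ring_glue\<close>), so \<open>fRf\<close> is \<open>(a + b)\<close>-Peirce and \<open>f'Rf'\<close> is \<open>(n - (a + b))\<close>-Peirce.
\<close>

section \<open>Corners\<close>

lemma corner_carrier: "carrier (corner R e) = (\<lambda>x. e \<otimes>\<^bsub>R\<^esub> x \<otimes>\<^bsub>R\<^esub> e) ` carrier R"
  by (auto simp: corner_def)

lemma corner_simps [simp]:
  "one (corner R e) = e" "zero (corner R e) = zero R"
  "mult (corner R e) = mult R" "add (corner R e) = add R"
  by (simp_all add: corner_def)

lemma corner_carrier_iff:
  fixes R (structure)
  assumes "ring R" "idempotent_elem R e"
  shows "x \<in> carrier (corner R e) \<longleftrightarrow>
    x \<in> carrier R \<and> e \<otimes> x = x \<and> x \<otimes> e = x"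
proof -
  interpret ring R by fact
  have e: "e \<in> carrier R" "e \<otimes> e = e"
    using assms(2) by (auto simp: idempotent_elem_def)
  have "e \<otimes> (e \<otimes> y \<otimes> e) = (e \<otimes> e) \<otimes> y \<otimes> e" "e \<otimes> y \<otimes> e \<otimes> e = e \<otimes> y \<otimes> (e \<otimes> e)"
    if "y \<in> carrier R" for y
    using e(1) that by (simp_all add: m_assoc)
  then have absorb: "e \<otimes> (e \<otimes> y \<otimes> e) = e \<otimes> y \<otimes> e" "e \<otimes> y \<otimes> e \<otimes> e = e \<otimes> y \<otimes> e"
    if "y \<in> carrier R" for y
    using e(2) that by simp_all
  show ?thesis
  proof
    assume "x \<in> carrier (corner R e)"
    then show "x \<in> carrier R \<and> e \<otimes> x = x \<and> x \<otimes> e = x"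
      using absorb e(1) by (auto simp: corner_carrier)
  next
    assume "x \<in> carrier R \<and> e \<otimes> x = x \<and> x \<otimes> e = x"
    then have "x \<in> carrier R" "x = e \<otimes> x \<otimes> e" by simp_all
    then show "x \<in> carrier (corner R e)" unfolding corner_carrier by (rule rev_image_eqI)
  qed
qed

lemma ring_corner:
  fixes R (structure)
  assumes "ring R" "idempotent_elem R e"
  shows "ring (corner R e)"
proof -
  interpret ring R by fact
  have e: "e \<in> carrier R" "e \<otimes> e = e"
    using assms(2) by (auto simp: idempotent_elem_def)
  note iff = corner_carrier_iff[OF assms]
  show ?thesis
  proof (rule ringI)
    show "abelian_group (corner R e)"
    proof (rule abelian_groupI)
      fix x assume "x \<in> carrier (corner R e)"
      then show "\<exists>y\<in>carrier (corner R e). y \<oplus>\<^bsub>corner R e\<^esub> x = \<zero>\<^bsub>corner R e\<^esub>"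
        using e unfolding iff
        by (intro bexI[of _ "\<ominus> x"]) (auto simp: iff l_neg r_minus l_minus)
    qed (use e in \<open>auto simp: iff a_ac r_distr l_distr\<close>)
    show "monoid (corner R e)"
    proof (rule monoidI)
      fix x y assume "x \<in> carrier (corner R e)" "y \<in> carrier (corner R e)"
      then show "x \<otimes>\<^bsub>corner R e\<^esub> y \<in> carrier (corner R e)"
        using e m_assoc[of e x y, symmetric] m_assoc[of x y e] by (simp add: iff)
    qed (use e in \<open>auto simp: iff m_assoc\<close>)
  qed (use e in \<open>auto simp: iff l_distr r_distr\<close>)
qed

text \<open>
  The negation of a ring is determined by its carrier as well as by its addition, so it does not
  unfold along with the operations of a corner; uniqueness of negatives identifies the two.
\<close>

lemma corner_minus:
  fixes R (structure)
  assumes "ring R" "idempotent_elem R e" "x \<in> carrier (corner R e)" "y \<in> carrier (corner R e)"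
  shows "x \<ominus>\<^bsub>corner R e\<^esub> y = x \<ominus> y"
proof -
  interpret ring R by fact
  interpret C: ring "corner R e" using assms by (intro ring_corner)
  have "\<ominus>\<^bsub>corner R e\<^esub> y \<in> carrier R" "y \<in> carrier R"
    using C.a_inv_closed[OF assms(4)] assms corner_carrier_iff[OF assms(1,2)] by auto
  moreover have "\<ominus>\<^bsub>corner R e\<^esub> y \<oplus> y = \<zero>"
    using C.l_neg[OF assms(4)] by simp
  ultimately have "\<ominus>\<^bsub>corner R e\<^esub> y = \<ominus> y"
    using minus_equality by metis
  then show ?thesis by (simp add: a_minus_def)
qed

text \<open>
  A corner of a corner is a corner of the whole ring, literally equal to it as a record, because
  \<open>pe = p = ep\<close> gives \<open>p(exe)p = pxp\<close>.
\<close>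

lemma corner_corner:
  fixes R (structure)
  assumes "ring R" "idempotent_elem R e" "p \<in> carrier (corner R e)"
  shows "corner (corner R e) p = corner R p"
proof -
  interpret ring R by fact
  have e: "e \<in> carrier R" and p: "p \<in> carrier R" "e \<otimes> p = p" "p \<otimes> e = p"
    using assms corner_carrier_iff[OF assms(1,2)] by (auto simp: idempotent_elem_def)
  have eq: "p \<otimes> (e \<otimes> x \<otimes> e) \<otimes> p = p \<otimes> x \<otimes> p" if "x \<in> carrier R" for x
  proof -
    have "p \<otimes> (e \<otimes> x \<otimes> e) \<otimes> p = (p \<otimes> e) \<otimes> x \<otimes> (e \<otimes> p)"
      using e p(1) that by (simp add: m_assoc)
    then show ?thesis using p by simp
  qed
  have "carrier (corner (corner R e) p) = (\<lambda>x. p \<otimes> (e \<otimes> x \<otimes> e) \<otimes> p) ` carrier R"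
    by (simp add: corner_carrier image_image)
  also have "\<dots> = carrier (corner R p)"
    unfolding corner_carrier using eq by (rule image_cong[OF refl])
  finally have "carrier (corner (corner R e) p) = carrier (corner R p)" .
  moreover have "corner (corner R e) p = R\<lparr>carrier := carrier (corner (corner R e) p), one := p\<rparr>"
    unfolding corner_def[of "corner R e"] by (simp add: corner_def[of R])
  moreover have "corner R p = R\<lparr>carrier := carrier (corner R p), one := p\<rparr>"
    unfolding corner_def by simp
  ultimately show ?thesis by metis
qed

lemma corner_one:
  fixes R (structure)
  assumes "ring R"
  shows "corner R \<one> = R"
proof -
  interpret ring R by fact
  have "carrier (corner R \<one>) = carrier R"
    unfolding corner_carrier by simp
  then show ?thesis by (simp add: corner_def)
qed

lemma corner_trivial_iff:
  fixes R (structure)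
  assumes "ring R" "idempotent_elem R e"
  shows "carrier (corner R e) = {\<zero>} \<longleftrightarrow> e = \<zero>"
proof -
  interpret ring R by fact
  have e: "e \<in> carrier R" using assms(2) by (simp add: idempotent_elem_def)
  show ?thesis
  proof
    assume "carrier (corner R e) = {\<zero>}"
    moreover have "e \<in> carrier (corner R e)"
      using assms(2) unfolding corner_carrier_iff[OF assms] by (simp add: idempotent_elem_def)
    ultimately show "e = \<zero>" by simp
  next
    assume "e = \<zero>"
    then show "carrier (corner R e) = {\<zero>}" by (auto simp: corner_carrier)
  qed
qed

lemma idempotent_elem_complement:
  fixes R (structure)
  assumes "ring R" "idempotent_elem R e"
  shows "idempotent_elem R (\<one> \<ominus> e)"
proof -
  interpret ring R by fact
  show ?thesis using assms(2)
    by (auto simp: idempotent_elem_def a_minus_def l_distr r_distr l_minus r_minus r_neg)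
qed

lemma complement_complement:
  fixes R (structure)
  assumes "ring R" "e \<in> carrier R"
  shows "\<one> \<ominus> (\<one> \<ominus> e) = e"
proof -
  interpret ring R by fact
  show ?thesis using assms(2) by (simp add: a_minus_def minus_add r_neg flip: a_assoc)
qed

section \<open>Peirce trivial idempotents\<close>

lemma Peirce_trivial_idempotent: "Peirce_trivial R e \<Longrightarrow> idempotent_elem R e"
  by (simp add: Peirce_trivial_def inner_Peirce_trivial_def)

lemma Peirce_trivial_closed: "Peirce_trivial R e \<Longrightarrow> e \<in> carrier R"
  by (simp add: Peirce_trivial_def inner_Peirce_trivial_def idempotent_elem_def)

text \<open>
  Expanding the middle factor \<open>1 - e\<close> turns the vanishing of \<open>ex(1 - e)ye\<close> into the
  multiplicativity of the compression \<open>x \<mapsto> exe\<close>.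
\<close>

lemma inner_Peirce_trivial_iff:
  fixes R (structure)
  assumes "ring R"
  shows "inner_Peirce_trivial R e \<longleftrightarrow> idempotent_elem R e \<and>
    (\<forall>x\<in>carrier R. \<forall>y\<in>carrier R.
      e \<otimes> (x \<otimes> y) \<otimes> e = (e \<otimes> x \<otimes> e) \<otimes> (e \<otimes> y \<otimes> e))"
proof -
  interpret ring R by fact
  have "e \<otimes> x \<otimes> (\<one> \<ominus> e) \<otimes> y \<otimes> e = \<zero> \<longleftrightarrow> e \<otimes> (x \<otimes> y) \<otimes> e = (e \<otimes> x \<otimes> e) \<otimes> (e \<otimes> y \<otimes> e)"
    if "idempotent_elem R e" "x \<in> carrier R" "y \<in> carrier R" for x y
  proof -
    have e: "e \<in> carrier R" "e \<otimes> e = e" using that by (auto simp: idempotent_elem_def)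
    have "e \<otimes> x \<otimes> (\<one> \<ominus> e) \<otimes> y \<otimes> e = e \<otimes> (x \<otimes> y) \<otimes> e \<ominus> e \<otimes> x \<otimes> e \<otimes> y \<otimes> e"
      using e that by (simp add: a_minus_def r_distr l_distr r_minus l_minus m_assoc)
    moreover have "(e \<otimes> x \<otimes> e) \<otimes> (e \<otimes> y \<otimes> e) = e \<otimes> x \<otimes> (e \<otimes> e) \<otimes> y \<otimes> e"
      using e(1) that by (simp add: m_assoc)
    moreover have "u \<ominus> v = \<zero> \<longleftrightarrow> u = v" if "u \<in> carrier R" "v \<in> carrier R" for u v
      using that by (metis a_minus_def minus_equality minus_minus r_neg a_inv_closed)
    ultimately show ?thesis
      using e that by simp
  qed
  then show ?thesis unfolding inner_Peirce_trivial_def by blast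
qed

lemma outer_Peirce_trivial_iff:
  fixes R (structure)
  assumes "ring R" "e \<in> carrier R"
  shows "outer_Peirce_trivial R e \<longleftrightarrow> inner_Peirce_trivial R (\<one> \<ominus> e)"
  using idempotent_elem_complement[OF assms(1), of e]
    idempotent_elem_complement[OF assms(1), of "\<one> \<ominus> e"] complement_complement[OF assms]
  unfolding outer_Peirce_trivial_def inner_Peirce_trivial_def by auto

lemma Peirce_trivial_complement:
  fixes R (structure)
  assumes "ring R" "Peirce_trivial R e"
  shows "Peirce_trivial R (\<one> \<ominus> e)"
proof -
  interpret ring R by fact
  show ?thesis
    using assms Peirce_trivial_closed[OF assms(2)] outer_Peirce_trivial_iff[of R e] outer_Peirce_trivial_iff[of R "\<one> \<ominus> e"]
      complement_complement[of R e]
    by (simp add: Peirce_trivial_def)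
qed

lemma ring_hom_minus:
  assumes "ring R" "ring S" "h \<in> ring_hom R S" "x \<in> carrier R" "y \<in> carrier R"
  shows "h (x \<ominus>\<^bsub>R\<^esub> y) = h x \<ominus>\<^bsub>S\<^esub> h y"
proof -
  interpret R: ring R by fact
  interpret S: ring S by fact
  have "h (x \<ominus>\<^bsub>R\<^esub> y) \<oplus>\<^bsub>S\<^esub> h y = h x"
    using assms by (simp add: a_minus_def R.a_assoc R.l_neg flip: ring_hom_add)
  moreover have "h (x \<ominus>\<^bsub>R\<^esub> y) = h (x \<ominus>\<^bsub>R\<^esub> y) \<oplus>\<^bsub>S\<^esub> h y \<ominus>\<^bsub>S\<^esub> h y"
    using assms by (simp add: a_minus_def S.a_assoc S.r_neg ring_hom_closed[OF assms(3)])
  ultimately show ?thesis by simp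
qed

text \<open>
  Surjectivity is essential: the defining identity for \<open>h e\<close> ranges over all elements of \<open>S\<close>.
\<close>

lemma inner_Peirce_trivial_hom_image:
  assumes "ring R" "ring S" "h \<in> ring_hom R S" "h ` carrier R = carrier S"
    "inner_Peirce_trivial R e"
  shows "inner_Peirce_trivial S (h e)"
proof -
  interpret R: ring R by fact
  interpret S: ring S by fact
  have e: "e \<in> carrier R" "e \<otimes>\<^bsub>R\<^esub> e = e"
    using assms(5) by (auto simp: inner_Peirce_trivial_def idempotent_elem_def)
  have mult: "h (x \<otimes>\<^bsub>R\<^esub> y) = h x \<otimes>\<^bsub>S\<^esub> h y" if "x \<in> carrier R" "y \<in> carrier R" for x y
    using ring_hom_mult[OF assms(3)] that .
  have "h e \<otimes>\<^bsub>S\<^esub> (h x \<otimes>\<^bsub>S\<^esub> h y) \<otimes>\<^bsub>S\<^esub> h e = (h e \<otimes>\<^bsub>S\<^esub> h x \<otimes>\<^bsub>S\<^esub> h e) \<otimes>\<^bsub>S\<^esub> (h e \<otimes>\<^bsub>S\<^esub> h y \<otimes>\<^bsub>S\<^esub> h e)"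
    if "x \<in> carrier R" "y \<in> carrier R" for x y
    using assms(5) that e unfolding inner_Peirce_trivial_iff[OF assms(1)]
    by (simp flip: mult)
  moreover have "h e \<otimes>\<^bsub>S\<^esub> h e = h e" using e by (simp flip: mult)
  ultimately show ?thesis
    using e ring_hom_closed[OF assms(3)]
    unfolding inner_Peirce_trivial_iff[OF assms(2)] idempotent_elem_def assms(4)[symmetric]
    by auto
qed

lemma Peirce_trivial_hom_image:
  assumes "ring R" "ring S" "h \<in> ring_hom R S" "h ` carrier R = carrier S" "Peirce_trivial R e"
  shows "Peirce_trivial S (h e)"
proof -
  interpret R: ring R by fact
  have e: "e \<in> carrier R"
    using assms(5) by (rule Peirce_trivial_closed)
  then have "h (\<one>\<^bsub>R\<^esub> \<ominus>\<^bsub>R\<^esub> e) = \<one>\<^bsub>S\<^esub> \<ominus>\<^bsub>S\<^esub> h e" "h e \<in> carrier S"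
    using ring_hom_minus[OF assms(1-3)] ring_hom_one[OF assms(3)] ring_hom_closed[OF assms(3)]
    by auto
  then show ?thesis
    using inner_Peirce_trivial_hom_image[OF assms(1-4)] assms e
    by (metis Peirce_trivial_def outer_Peirce_trivial_iff)
qed

lemma compression_hom:
  fixes R (structure)
  assumes "ring R" "Peirce_trivial R e"
  shows "(\<lambda>x. e \<otimes> x \<otimes> e) \<in> ring_hom R (corner R e)"
proof -
  interpret ring R by fact
  have e: "e \<in> carrier R" "e \<otimes> e = e"
    using Peirce_trivial_idempotent[OF assms(2)] by (auto simp: idempotent_elem_def)
  show ?thesis
    using e assms(2)
    by (intro ring_hom_memI)
      (auto simp: corner_carrier Peirce_trivial_def inner_Peirce_trivial_iff[OF assms(1)] l_distr r_distr)
qed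

text \<open>
  The compression is a homomorphism onto \<open>eRe\<close>, and it sends \<open>f\<close> to \<open>efe\<close>.
\<close>

lemma Peirce_trivial_compression:
  assumes "ring R" "Peirce_trivial R e" "Peirce_trivial R f"
  shows "Peirce_trivial (corner R e) (e \<otimes>\<^bsub>R\<^esub> f \<otimes>\<^bsub>R\<^esub> e)"
  by (rule Peirce_trivial_hom_image[OF assms(1) _ compression_hom[OF assms(1,2)] _ assms(3)])
    (auto simp: corner_carrier intro: ring_corner Peirce_trivial_idempotent assms)

section \<open>Isomorphic corners\<close>

lemma ring_iso_corner:
  assumes "ring R" "ring S" "h \<in> ring_iso R S" "idempotent_elem R e"
  shows "h \<in> ring_iso (corner R e) (corner S (h e))"
proof -
  interpret R: ring R by fact
  have h: "h \<in> ring_hom R S" "bij_betw h (carrier R) (carrier S)"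
    using assms(3) by (auto simp: ring_iso_def)
  have e: "e \<in> carrier R" using assms(4) by (simp add: idempotent_elem_def)
  have sub: "carrier (corner R e) \<subseteq> carrier R"
    using corner_carrier_iff[OF assms(1,4)] by blast
  have mult: "h (e \<otimes>\<^bsub>R\<^esub> x \<otimes>\<^bsub>R\<^esub> e) = h e \<otimes>\<^bsub>S\<^esub> h x \<otimes>\<^bsub>S\<^esub> h e" if "x \<in> carrier R" for x
    using e that ring_hom_mult[OF h(1)] by simp
  have "h ` carrier (corner R e) = (\<lambda>x. h e \<otimes>\<^bsub>S\<^esub> h x \<otimes>\<^bsub>S\<^esub> h e) ` carrier R"
    unfolding corner_carrier image_image using mult by (rule image_cong[OF refl])
  also have "\<dots> = carrier (corner S (h e))"
    using bij_betw_imp_surj_on[OF h(2), symmetric] by (simp only: corner_carrier image_image)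
  finally have "h ` carrier (corner R e) = carrier (corner S (h e))" .
  moreover have "inj_on h (carrier (corner R e))"
    using h(2) sub by (meson bij_betw_def inj_on_subset)
  moreover have "h \<in> ring_hom (corner R e) (corner S (h e))"
    using sub calculation(1) ring_hom_mult[OF h(1)] ring_hom_add[OF h(1)]
    by (intro ring_hom_memI) (auto simp: subset_iff)
  ultimately show ?thesis by (simp add: ring_iso_def bij_betw_def)
qed

text \<open>
  The classical isomorphism between the corners of \<open>ab\<close> and \<open>ba\<close>; its inverse is \<open>y \<mapsto> ayb\<close>,
  since \<open>a(bxa)b = (ab)x(ab) = x\<close> for \<open>x\<close> in the corner of \<open>ab\<close>.
\<close>

lemma corner_swap_iso:
  fixes R (structure)
  assumes "ring R" "a \<in> carrier R" "b \<in> carrier R"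
    "idempotent_elem R (a \<otimes> b)" "idempotent_elem R (b \<otimes> a)"
  shows "(\<lambda>x. b \<otimes> x \<otimes> a) \<in> ring_iso (corner R (a \<otimes> b)) (corner R (b \<otimes> a))"
proof -
  interpret ring R by fact
  note ab = assms(2,3)
  \<comment> \<open>Stated for arbitrary \<open>a\<close> and \<open>b\<close>, so that it also serves for the inverse map, with the
    two elements exchanged.\<close>
  have swap: "b \<otimes> x \<otimes> a \<in> carrier (corner R (b \<otimes> a)) \<and> a \<otimes> (b \<otimes> x \<otimes> a) \<otimes> b = x"
    if "x \<in> carrier (corner R (a \<otimes> b))" "a \<in> carrier R" "b \<in> carrier R"
      "idempotent_elem R (a \<otimes> b)" "idempotent_elem R (b \<otimes> a)" for a b x
  proof -
    have x: "x \<in> carrier R" "a \<otimes> b \<otimes> x = x" "x \<otimes> (a \<otimes> b) = x"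
      using that corner_carrier_iff[OF assms(1) that(4)] by auto
    have "b \<otimes> a \<otimes> (b \<otimes> x \<otimes> a) = b \<otimes> (a \<otimes> b \<otimes> x) \<otimes> a"
      "b \<otimes> x \<otimes> a \<otimes> (b \<otimes> a) = b \<otimes> (x \<otimes> (a \<otimes> b)) \<otimes> a"
      "a \<otimes> (b \<otimes> x \<otimes> a) \<otimes> b = a \<otimes> b \<otimes> x \<otimes> (a \<otimes> b)"
      using that x(1) by (simp_all add: m_assoc)
    then show ?thesis
      unfolding corner_carrier_iff[OF assms(1) that(5)] using x that by simp
  qed
  have "bij_betw (\<lambda>x. b \<otimes> x \<otimes> a) (carrier (corner R (a \<otimes> b))) (carrier (corner R (b \<otimes> a)))"
    by (rule bij_betw_byWitness[where f' = "\<lambda>y. a \<otimes> y \<otimes> b"]) (use swap assms in auto)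
  moreover have "(\<lambda>x. b \<otimes> x \<otimes> a) \<in> ring_hom (corner R (a \<otimes> b)) (corner R (b \<otimes> a))"
  proof (rule ring_hom_memI)
    fix x y assume "x \<in> carrier (corner R (a \<otimes> b))" "y \<in> carrier (corner R (a \<otimes> b))"
    then have xy: "x \<in> carrier R" "y \<in> carrier R" "x \<otimes> (a \<otimes> b) = x"
      using corner_carrier_iff[OF assms(1,4)] by auto
    have "b \<otimes> x \<otimes> a \<otimes> (b \<otimes> y \<otimes> a) = b \<otimes> (x \<otimes> (a \<otimes> b) \<otimes> y) \<otimes> a"
      using ab xy(1,2) by (simp add: m_assoc)
    then show "b \<otimes> (x \<otimes>\<^bsub>corner R (a \<otimes> b)\<^esub> y) \<otimes> a =
        b \<otimes> x \<otimes> a \<otimes>\<^bsub>corner R (b \<otimes> a)\<^esub> (b \<otimes> y \<otimes> a)"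
      using xy by simp
    show "b \<otimes> (x \<oplus>\<^bsub>corner R (a \<otimes> b)\<^esub> y) \<otimes> a =
        b \<otimes> x \<otimes> a \<oplus>\<^bsub>corner R (b \<otimes> a)\<^esub> (b \<otimes> y \<otimes> a)"
      using ab xy by (simp add: l_distr r_distr)
  next
    have "b \<otimes> (a \<otimes> b) \<otimes> a = b \<otimes> a \<otimes> (b \<otimes> a)" using ab by (simp add: m_assoc)
    then show "b \<otimes> \<one>\<^bsub>corner R (a \<otimes> b)\<^esub> \<otimes> a = \<one>\<^bsub>corner R (b \<otimes> a)\<^esub>"
      using assms(5) by (simp add: idempotent_elem_def)
  qed (use swap assms in blast)
  ultimately show ?thesis by (simp add: ring_iso_def)
qed

section \<open>The Peirce number of a ring\<close>

lemma Peirce_ring_0_iff: "Peirce_ring 0 R \<longleftrightarrow> ring R \<and> carrier R = {\<zero>\<^bsub>R\<^esub>}"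
  by (auto elim: Peirce_ring.cases intro: Peirce_ring_0)

lemma Peirce_ring_iso:
  assumes "Peirce_ring n R" "h \<in> ring_iso R S" "ring S"
  shows "Peirce_ring n S"
  using assms
proof (induction arbitrary: S h rule: Peirce_ring.induct)
  case (Peirce_ring_0 R)
  have "h \<in> ring_hom R S" "h ` carrier R = carrier S"
    using Peirce_ring_0.prems by (auto simp: ring_iso_def bij_betw_def)
  then have "carrier S = {\<zero>\<^bsub>S\<^esub>}"
    using Peirce_ring_0.hyps Peirce_ring_0.prems(2) ring_hom_zero[of h R S] by simp
  then show ?case
    by (rule Peirce_ring.Peirce_ring_0[OF Peirce_ring_0.prems(2)])
next
  case (Peirce_ring_1 R)
  have h: "h \<in> ring_hom R S" "bij_betw h (carrier R) (carrier S)" "h ` carrier R = carrier S"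
    using Peirce_ring_1.prems by (auto simp: ring_iso_def bij_betw_def)
  interpret R: ring R by fact
  interpret S: ring S by fact
  let ?g = "inv_into (carrier R) h"
  have g: "?g \<in> ring_hom S R" "?g ` carrier S = carrier R"
    using ring_iso_set_sym[OF Peirce_ring_1.hyps(1) Peirce_ring_1.prems(1)] by (auto simp: ring_iso_def bij_betw_def)
  have h01: "h \<zero>\<^bsub>R\<^esub> = \<zero>\<^bsub>S\<^esub>" "h \<one>\<^bsub>R\<^esub> = \<one>\<^bsub>S\<^esub>"
    using ring_hom_zero[OF h(1)] ring_hom_one[OF h(1)] R.ring_axioms S.ring_axioms by auto
  have "{e. Peirce_trivial S e} = h ` {e. Peirce_trivial R e}"
  proof (intro equalityI subsetI)
    fix e assume "e \<in> {e. Peirce_trivial S e}"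
    then have e: "Peirce_trivial S e" "e \<in> carrier S"
      using Peirce_trivial_closed by auto
    have "Peirce_trivial R (?g e)"
      using Peirce_trivial_hom_image[OF S.ring_axioms R.ring_axioms g e(1)] .
    moreover have "h (?g e) = e" using e(2) h(3) by (simp add: f_inv_into_f)
    ultimately show "e \<in> h ` {e. Peirce_trivial R e}" by force
  qed (use Peirce_trivial_hom_image[OF R.ring_axioms S.ring_axioms h(1,3)] in auto)
  then have "{e. Peirce_trivial S e} = {\<zero>\<^bsub>S\<^esub>, \<one>\<^bsub>S\<^esub>}"
    using Peirce_ring_1.hyps h01 by simp
  moreover have "\<one>\<^bsub>S\<^esub> \<noteq> \<zero>\<^bsub>S\<^esub>"
    using Peirce_ring_1.hyps(2) h(2) h01
    by (metis R.one_closed R.zero_closed bij_betw_def inj_onD)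
  ultimately show ?case
    by (intro Peirce_ring.Peirce_ring_1 S.ring_axioms)
next
  case (Peirce_ring_step R n e m)
  have h: "h \<in> ring_hom R S" "h ` carrier R = carrier S"
    using Peirce_ring_step.prems by (auto simp: ring_iso_def bij_betw_def)
  interpret R: ring R by fact
  interpret S: ring S by fact
  have e: "idempotent_elem R e" "idempotent_elem R (\<one>\<^bsub>R\<^esub> \<ominus>\<^bsub>R\<^esub> e)"
    using Peirce_trivial_idempotent[OF Peirce_ring_step.hyps(3)]
      idempotent_elem_complement[OF R.ring_axioms] by auto
  have he: "Peirce_trivial S (h e)"
    using Peirce_trivial_hom_image[OF R.ring_axioms S.ring_axioms h] Peirce_ring_step.hyps by auto
  have hc: "h (\<one>\<^bsub>R\<^esub> \<ominus>\<^bsub>R\<^esub> e) = \<one>\<^bsub>S\<^esub> \<ominus>\<^bsub>S\<^esub> h e"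
    using ring_hom_minus[OF R.ring_axioms S.ring_axioms h(1)] e ring_hom_one[OF h(1)]
    by (simp add: idempotent_elem_def)
  note iso = ring_iso_corner[OF R.ring_axioms S.ring_axioms Peirce_ring_step.prems(1)]
  have "Peirce_ring m (corner S (h e))"
    using Peirce_trivial_idempotent[OF he]
    by (intro Peirce_ring_step.IH(1)[OF iso[OF e(1)]] ring_corner S.ring_axioms)
  moreover have "Peirce_ring (n - m) (corner S (\<one>\<^bsub>S\<^esub> \<ominus>\<^bsub>S\<^esub> h e))"
    using Peirce_trivial_idempotent[OF he]
    by (intro Peirce_ring_step.IH(2)[OF iso[OF e(2), unfolded hc]] ring_corner
        idempotent_elem_complement S.ring_axioms)
  ultimately show ?case
    using Peirce_ring.Peirce_ring_step[OF S.ring_axioms Peirce_ring_step.hyps(2) he]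
      Peirce_ring_step.hyps(4,5) by blast
qed

text \<open>
  When \<open>a\<close> and \<open>b\<close> are positive this is the inductive clause. A corner that is \<open>0\<close>-Peirce belongs
  to the idempotent \<open>0\<close>, and then the complementary corner is \<open>R\<close> itself.
\<close>

lemma Peirce_ring_glue:
  fixes R (structure)
  assumes "ring R" "Peirce_trivial R e"
    "Peirce_ring a (corner R e)" "Peirce_ring b (corner R (\<one> \<ominus> e))"
  shows "Peirce_ring (a + b) R"
proof -
  interpret ring R by fact
  have e: "idempotent_elem R e" "e \<in> carrier R" "idempotent_elem R (\<one> \<ominus> e)"
    using Peirce_trivial_idempotent[OF assms(2)] Peirce_trivial_closed[OF assms(2)]
      idempotent_elem_complement[OF assms(1)] by auto
  consider "a = 0" | "b = 0" | "a \<ge> 1" "b \<ge> 1" by linarith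
  then show ?thesis
  proof cases
    case 1
    then have "e = \<zero>"
      using assms(3) corner_trivial_iff[OF assms(1) e(1)] by (simp add: Peirce_ring_0_iff)
    then have "\<one> \<ominus> e = \<one>" by (simp add: a_minus_def)
    then show ?thesis using 1 assms(4) corner_one[OF assms(1)] by simp
  next
    case 2
    then have "\<one> \<ominus> e = \<zero>"
      using assms(4) corner_trivial_iff[OF assms(1) e(3)] by (simp add: Peirce_ring_0_iff)
    then have "e = \<one>"
      using complement_complement[OF assms(1) e(2)] by (simp add: a_minus_def)
    then show ?thesis using 2 assms(3) corner_one[OF assms(1)] by simp
  next
    case 3
    then show ?thesis
      using assms(3,4) Peirce_ring_step[OF assms(1) _ assms(2), of "a + b" a] by simp
  qed
qed

lemma complement_compression:
  fixes R (structure)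
  assumes "ring R" "idempotent_elem R e" "f \<in> carrier R"
  shows "\<one>\<^bsub>corner R e\<^esub> \<ominus>\<^bsub>corner R e\<^esub> (e \<otimes> f \<otimes> e) =
    e \<otimes> (\<one> \<ominus> f) \<otimes> e"
proof -
  interpret ring R by fact
  interpret C: ring "corner R e" using assms by (intro ring_corner)
  have e: "e \<in> carrier R" "e \<otimes> e = e" using assms(2) by (auto simp: idempotent_elem_def)
  have "e \<otimes> f \<otimes> e \<in> carrier (corner R e)" using assms(3) by (auto simp: corner_carrier)
  then show ?thesis
    using corner_minus[OF assms(1,2) C.one_closed] e assms(3)
    by (simp add: a_minus_def r_distr l_distr r_minus l_minus)
qed

text \<open>
  Here \<open>corner_swap_iso\<close> is applied to \<open>ef\<close> and \<open>fe\<close>, not to \<open>e\<close> and \<open>f\<close>: the products \<open>ef\<close> and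
  \<open>fe\<close> need not be idempotent, but \<open>(ef)(fe) = efe\<close> and \<open>(fe)(ef) = fef\<close> are, by Peirce triviality.
\<close>

lemma Peirce_ring_compression_swap:
  fixes R (structure)
  assumes "ring R" "Peirce_trivial R e" "Peirce_trivial R f"
    "Peirce_ring k (corner (corner R e) (e \<otimes> f \<otimes> e))"
  shows "Peirce_ring k (corner (corner R f) (f \<otimes> e \<otimes> f))"
proof -
  interpret ring R by fact
  have e: "idempotent_elem R e" "e \<in> carrier R" "e \<otimes> e = e"
    and f: "idempotent_elem R f" "f \<in> carrier R" "f \<otimes> f = f"
    using assms(2,3)[THEN Peirce_trivial_idempotent] by (auto simp: idempotent_elem_def)
  have idem: "idempotent_elem R (e \<otimes> f \<otimes> e)" "idempotent_elem R (f \<otimes> e \<otimes> f)"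
    using Peirce_trivial_compression[OF assms(1-3), THEN Peirce_trivial_idempotent]
      Peirce_trivial_compression[OF assms(1,3,2), THEN Peirce_trivial_idempotent] e f
    by (auto simp: idempotent_elem_def)
  have ab: "(e \<otimes> f) \<otimes> (f \<otimes> e) = e \<otimes> f \<otimes> e" "(f \<otimes> e) \<otimes> (e \<otimes> f) = f \<otimes> e \<otimes> f"
  proof -
    have "(e \<otimes> f) \<otimes> (f \<otimes> e) = e \<otimes> (f \<otimes> f) \<otimes> e" "(f \<otimes> e) \<otimes> (e \<otimes> f) = f \<otimes> (e \<otimes> e) \<otimes> f"
      using e(2) f(2) by (simp_all add: m_assoc)
    then show "(e \<otimes> f) \<otimes> (f \<otimes> e) = e \<otimes> f \<otimes> e" "(f \<otimes> e) \<otimes> (e \<otimes> f) = f \<otimes> e \<otimes> f"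
      using e f by simp_all
  qed
  have "corner (corner R e) (e \<otimes> f \<otimes> e) = corner R (e \<otimes> f \<otimes> e)"
    "corner (corner R f) (f \<otimes> e \<otimes> f) = corner R (f \<otimes> e \<otimes> f)"
    using corner_corner[OF assms(1) e(1)] corner_corner[OF assms(1) f(1)] e f
    by (auto simp: corner_carrier)
  moreover have "(\<lambda>x. f \<otimes> e \<otimes> x \<otimes> (e \<otimes> f)) \<in>
      ring_iso (corner R (e \<otimes> f \<otimes> e)) (corner R (f \<otimes> e \<otimes> f))"
    using corner_swap_iso[OF assms(1), of "e \<otimes> f" "f \<otimes> e"] idem e(2) f(2)
    unfolding ab by simp
  ultimately show ?thesis
    using assms(4) Peirce_ring_iso ring_corner[OF assms(1) idem(2)] by metis
qed

text \<open>
  The corner \<open>fRf\<close> is reassembled from its part inside \<open>eRe\<close> and its part inside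
  \<open>(1 - e)R(1 - e)\<close>: the two are moved over to the corners of \<open>fef\<close> and of its complement
  \<open>f(1 - e)f\<close> in \<open>fRf\<close>.
\<close>

lemma Peirce_ring_corner_glue:
  fixes R (structure)
  assumes "ring R" "Peirce_trivial R e" "Peirce_trivial R f"
    "Peirce_ring a (corner (corner R e) (e \<otimes> f \<otimes> e))"
    "Peirce_ring b (corner (corner R (\<one> \<ominus> e))
      ((\<one> \<ominus> e) \<otimes> f \<otimes> (\<one> \<ominus> e)))"
  shows "Peirce_ring (a + b) (corner R f)"
proof (rule Peirce_ring_glue)
  have f: "idempotent_elem R f" and e: "e \<in> carrier R"
    using Peirce_trivial_idempotent[OF assms(3)] Peirce_trivial_closed[OF assms(2)] by auto
  show "ring (corner R f)" using assms(1) f by (rule ring_corner)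
  show "Peirce_trivial (corner R f) (f \<otimes> e \<otimes> f)"
    using Peirce_trivial_compression[OF assms(1,3,2)] .
  show "Peirce_ring a (corner (corner R f) (f \<otimes> e \<otimes> f))"
    using Peirce_ring_compression_swap[OF assms(1-4)] .
  show "Peirce_ring b (corner (corner R f)
      (\<one>\<^bsub>corner R f\<^esub> \<ominus>\<^bsub>corner R f\<^esub> f \<otimes> e \<otimes> f))"
    unfolding complement_compression[OF assms(1) f e]
    using Peirce_ring_compression_swap[OF assms(1) Peirce_trivial_complement[OF assms(1,2)] assms(3,5)] .
qed

theorem theorem2p9:
  fixes R :: "('a, 'b) ring_scheme" and n :: nat and f :: 'a
  assumes "Peirce_ring n R"
    and "Peirce_trivial R f"
  shows "\<exists>k\<le>n. Peirce_ring k (corner R f) \<and> Peirce_ring (n - k) (corner R (\<one>\<^bsub>R\<^esub> \<ominus>\<^bsub>R\<^esub> f))"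
  using assms
proof (induction arbitrary: f rule: Peirce_ring.induct)
  case (Peirce_ring_0 R)
  interpret ring R by fact
  have f: "f = \<zero>\<^bsub>R\<^esub>" "\<one>\<^bsub>R\<^esub> \<ominus>\<^bsub>R\<^esub> f = \<one>\<^bsub>R\<^esub>"
    using Peirce_ring_0 Peirce_trivial_idempotent[of R f] one_closed
    by (auto simp: idempotent_elem_def a_minus_def)
  have "\<zero>\<^bsub>R\<^esub> = \<one>\<^bsub>R\<^esub>" using Peirce_ring_0 one_closed by auto
  then show ?case
    using Peirce_ring.Peirce_ring_0[of R] Peirce_ring_0.hyps corner_one[of R] f by auto
next
  case (Peirce_ring_1 R)
  interpret ring R by fact
  have "idempotent_elem R \<zero>\<^bsub>R\<^esub>" by (simp add: idempotent_elem_def)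
  then have zero: "Peirce_ring 0 (corner R \<zero>\<^bsub>R\<^esub>)"
    using corner_trivial_iff[of R "\<zero>\<^bsub>R\<^esub>"] ring_corner[of R "\<zero>\<^bsub>R\<^esub>"] ring_axioms
    by (simp add: Peirce_ring_0_iff)
  have one: "Peirce_ring 1 (corner R \<one>\<^bsub>R\<^esub>)"
    using Peirce_ring.Peirce_ring_1[of R] Peirce_ring_1.hyps corner_one[of R] by simp
  have minus: "\<one>\<^bsub>R\<^esub> \<ominus>\<^bsub>R\<^esub> \<zero>\<^bsub>R\<^esub> = \<one>\<^bsub>R\<^esub>" "\<one>\<^bsub>R\<^esub> \<ominus>\<^bsub>R\<^esub> \<one>\<^bsub>R\<^esub> = \<zero>\<^bsub>R\<^esub>" by (simp_all add: a_minus_def r_neg)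
  have "f = \<zero>\<^bsub>R\<^esub> \<or> f = \<one>\<^bsub>R\<^esub>" using Peirce_ring_1 by auto
  then show ?case
  proof
    assume "f = \<zero>\<^bsub>R\<^esub>"
    then show ?case using zero one minus by (intro exI[of _ 0]) simp
  next
    assume "f = \<one>\<^bsub>R\<^esub>"
    then show ?case using zero one minus by (intro exI[of _ 1]) simp
  qed
next
  case (Peirce_ring_step R n e m)
  interpret ring R by fact
  let ?e' = "\<one>\<^bsub>R\<^esub> \<ominus>\<^bsub>R\<^esub> e" and ?f' = "\<one>\<^bsub>R\<^esub> \<ominus>\<^bsub>R\<^esub> f"
  have triv: "Peirce_trivial R e" "Peirce_trivial R ?e'" "Peirce_trivial R f" "Peirce_trivial R ?f'"
    using Peirce_ring_step.hyps Peirce_ring_step.prems Peirce_trivial_complement ring_axioms by auto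
  have cl: "idempotent_elem R e" "idempotent_elem R ?e'" "f \<in> carrier R"
    using triv[THEN Peirce_trivial_idempotent] by (auto simp: idempotent_elem_def)
  obtain a where a: "a \<le> m" "Peirce_ring a (corner (corner R e) (e \<otimes>\<^bsub>R\<^esub> f \<otimes>\<^bsub>R\<^esub> e))"
      "Peirce_ring (m - a) (corner (corner R e) (e \<otimes>\<^bsub>R\<^esub> ?f' \<otimes>\<^bsub>R\<^esub> e))"
    using Peirce_ring_step.IH(1)[OF Peirce_trivial_compression[OF ring_axioms triv(1,3)]]
    unfolding complement_compression[OF ring_axioms cl(1,3)] by blast
  obtain b where b: "b \<le> n - m" "Peirce_ring b (corner (corner R ?e') (?e' \<otimes>\<^bsub>R\<^esub> f \<otimes>\<^bsub>R\<^esub> ?e'))"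
      "Peirce_ring (n - m - b) (corner (corner R ?e') (?e' \<otimes>\<^bsub>R\<^esub> ?f' \<otimes>\<^bsub>R\<^esub> ?e'))"
    using Peirce_ring_step.IH(2)[OF Peirce_trivial_compression[OF ring_axioms triv(2,3)]]
    unfolding complement_compression[OF ring_axioms cl(2,3)] by blast
  have "Peirce_ring (a + b) (corner R f)"
    using Peirce_ring_corner_glue[OF ring_axioms triv(1,3) a(2) b(2)] .
  moreover have "Peirce_ring (m - a + (n - m - b)) (corner R ?f')"
    using Peirce_ring_corner_glue[OF ring_axioms triv(1,4) a(3) b(3)] .
  moreover have "m - a + (n - m - b) = n - (a + b)" "a + b \<le> n"
    using a(1) b(1) \<open>m < n\<close> by auto
  ultimately show ?case by (intro exI[of _ "a + b"]) simp
qed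

end
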